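(* Let $a,m$ be integers with $1<a<m$ and $\gcd(a,m)=1$, and put $\lambda=\frac{a}{m}$. Let $\widehat{\mathcal X}_0,\widehat{\mathcal X}_1,\dots,\widehat{\mathcal X}_N$ be the s-states of Qin's algorithm on input $(a,m)$, and let $\frac{\alpha_k}{\beta_k}$ be the $k$-th convergent of the continued fraction $[0,q_1,q_2,\dots,q_N,q_{N+1}]$ of $\lambda$. Then for every $k$ with $1\le k\le N$, $$\widehat{\mathcal X}_k=\begin{cases}\begin{pmatrix}\beta_{k-1}&\alpha_{k-1}\\ \beta_k&\alpha_k\end{pmatrix}\widehat{\mathcal X}_0 & \text{if } k \text{ is odd},\\[2ex] \begin{pmatrix}\beta_k&\alpha_k\\ \beta_{k-1}&\alpha_{k-1}\end{pmatrix}\widehat{\mathcal X}_0 & \text{if } k \text{ is even}.\end{cases}$$ In other words, $$\widehat{\mathcal X}_k=\begin{cases}\begin{pmatrix}\beta_{k-1}& m\beta_{k-1}\left(\frac{\alpha_{k-1}}{\beta_{k-1}}-\lambda\right)\\ \beta_k& m\beta_k\left(\frac{\alpha_k}{\beta_k}-\lambda\right)\end{pmatrix} & \text{if } k \text{ is odd},\\[3ex] \begin{pmatrix}\beta_k& m\beta_k\left(\frac{\alpha_k}{\beta_k}-\lambda\right)\\ \beta_{k-1}& m\beta_{k-1}\left(\frac{\alpha_{k-1}}{\beta_{k-1}}-\lambda\right)\end{pmatrix} & \text{if } k \text{ is even}.\end{cases}$$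
   Context: Qin's algorithm on input $(a,m)$ (integers, $1<a<m$, $\gcd(a,m)=1$) produces a finite sequence of states $\mathcal X_k=\begin{pmatrix}x_{11}^{(k)}&x_{12}^{(k)}\\ x_{21}^{(k)}&x_{22}^{(k)}\end{pmatrix}$ as follows. The initial state is $\mathcal X_0=\begin{pmatrix}1&a\\0&m\end{pmatrix}$. For $k\ge 1$, as long as $x_{12}^{(k-1)}\neq 1$, step $k$ produces $\mathcal X_k$ from $\mathcal X_{k-1}$: (i) if $x_{22}^{(k-1)}>x_{12}^{(k-1)}$, set $q_k=\left\lfloor \frac{x_{22}^{(k-1)}-1}{x_{12}^{(k-1)}}\right\rfloor$, $x_{21}^{(k)}=x_{21}^{(k-1)}+q_kx_{11}^{(k-1)}$, $x_{22}^{(k)}=x_{22}^{(k-1)}-q_kx_{12}^{(k-1)}$, and leave the first row unchanged; (ii) if $x_{12}^{(k-1)}>x_{22}^{(k-1)}$, set $q_k=\left\lfloor \frac{x_{12}^{(k-1)}-1}{x_{22}^{(k-1)}}\right\rfloor$, $x_{11}^{(k)}=x_{11}^{(k-1)}+q_kx_{21}^{(k-1)}$, $x_{12}^{(k)}=x_{12}^{(k-1)}-q_kx_{22}^{(k-1)}$, and leave the second row unchanged. The algorithm stops at the first index $N$ with $x_{12}^{(N)}=1$; $N$ is the number of steps. The s-state at step $k$ is $\widehat{\mathcal X}_k=\begin{pmatrix}x_{11}^{(k)}&-x_{12}^{(k)}\\ x_{21}^{(k)}&x_{22}^{(k)}\end{pmatrix}$. Put $q_{N+1}=x_{22}^{(N)}$.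 The continued fraction of $\lambda=a/m$ is taken in the form $[0,q_1,\dots,q_N,q_{N+1}]$ (the last partial quotient may equal $1$). Its convergents $\alpha_k/\beta_k$ are given by $\alpha_0=0$, $\alpha_1=1$, $\beta_0=1$, $\beta_1=q_1$, and $\alpha_k=q_k\alpha_{k-1}+\alpha_{k-2}$, $\beta_k=q_k\beta_{k-1}+\beta_{k-2}$ for $k\ge 2$. *)

theory Defs
  imports "HOL-Analysis.Analysis"
begin

abbreviation mat2 :: "'a::zero \<Rightarrow> 'a \<Rightarrow> 'a \<Rightarrow> 'a \<Rightarrow> 'a^2^2" where
  "mat2 a b c d \<equiv> vector [vector [a, b], vector [c, d]]"

definition qin_init :: "int \<Rightarrow> int \<Rightarrow> int^2^2" where
  "qin_init a m = mat2 1 a 0 m"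

(* For integers, (u - 1) div v is the floor of the rational (u - 1) / v. *)
definition qin_quot :: "int^2^2 \<Rightarrow> int" where
  "qin_quot X =
     (if X$2$2 > X$1$2 then (X$2$2 - 1) div (X$1$2)
      else if X$1$2 > X$2$2 then (X$1$2 - 1) div (X$2$2)
      else 0)"

(* A state with upper right entry 1 is final and is kept unchanged, which makes the step total.
   The last branch (equal entries in the right column) is not reached on coprime input. *)
definition qin_step :: "int^2^2 \<Rightarrow> int^2^2" where
  "qin_step X =
     (if X$1$2 = 1 then X
      else if X$2$2 > X$1$2 then
        mat2 (X$1$1) (X$1$2)
             (X$2$1 + qin_quot X * X$1$1) (X$2$2 - qin_quot X * X$1$2)
      else if X$1$2 > X$2$2 then
        mat2 (X$1$1 + qin_quot X * X$2$1) (X$1$2 - qin_quot X * X$2$2)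
             (X$2$1) (X$2$2)
      else X)"

definition qin_state :: "int \<Rightarrow> int \<Rightarrow> nat \<Rightarrow> int^2^2" where
  "qin_state a m k = (qin_step ^^ k) (qin_init a m)"

(* The number N of steps; the set of candidates is nonempty by qin_terminates below. *)
definition qin_N :: "int \<Rightarrow> int \<Rightarrow> nat" where
  "qin_N a m = (LEAST k. qin_state a m k $ 1 $ 2 = 1)"

definition s_state :: "int \<Rightarrow> int \<Rightarrow> nat \<Rightarrow> int^2^2" where
  "s_state a m k =
     (let X = qin_state a m k in mat2 (X$1$1) (- (X$1$2)) (X$2$1) (X$2$2))"

(* The partial quotients of [0, q_1, ..., q_N, q_(N+1)], whose value is a / m (qin_cfrac_value
   below); the value beyond index N + 1 is junk. *)
definition qin_q :: "int \<Rightarrow> int \<Rightarrow> nat \<Rightarrow> int" where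
  "qin_q a m k =
     (if k = 0 then 0
      else if k \<le> qin_N a m then qin_quot (qin_state a m (k - 1))
      else if k = qin_N a m + 1 then qin_state a m (qin_N a m) $ 2 $ 2
      else 0)"

(* Numerators and denominators of the convergents of [0, q 1, q 2, ...]. *)
fun conv_num :: "(nat \<Rightarrow> int) \<Rightarrow> nat \<Rightarrow> int" where
  "conv_num q 0 = 0"
| "conv_num q (Suc 0) = 1"
| "conv_num q (Suc (Suc k)) = q (Suc (Suc k)) * conv_num q (Suc k) + conv_num q k"

fun conv_den :: "(nat \<Rightarrow> int) \<Rightarrow> nat \<Rightarrow> int" where
  "conv_den q 0 = 1"
| "conv_den q (Suc 0) = q 1"
| "conv_den q (Suc (Suc k)) = q (Suc (Suc k)) * conv_den q (Suc k) + conv_den q k"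

lemma sub_div_bounds:
  fixes u v :: int
  assumes "0 < v" "v < u"
  shows "0 < u - (u - 1) div v * v" "u - (u - 1) div v * v < u"
proof -
  have "(u - 1) div v * v \<le> u - 1"
    using div_mult_mod_eq[of "u - 1" v] pos_mod_sign[OF assms(1), of "u - 1"] by linarith
  then show "0 < u - (u - 1) div v * v" by linarith
  have "0 < (u - 1) div v"
    using assms by (simp add: pos_imp_zdiv_pos_iff)
  then show "u - (u - 1) div v * v < u"
    using assms by (simp add: zero_less_mult_iff)
qed

lemma coprime_sub_mult:
  fixes u v c :: int
  assumes "coprime u v"
  shows "coprime (u - c * v) v"
  using assms by (simp add: coprime_iff_gcd_eq_1 gcd_diff1 gcd.commute[of _ v])
    (metis gcd_add_mult diff_conv_add_uminus mult_minus_left add.commute)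

lemma qin_step_decreases:
  assumes "0 < X$1$2" "0 < X$2$2" "coprime (X$1$2) (X$2$2)" "X$1$2 \<noteq> 1"
  defines "Y \<equiv> qin_step X"
  shows "0 < Y$1$2" "0 < Y$2$2" "coprime (Y$1$2) (Y$2$2)"
    "Y$1$2 + Y$2$2 < X$1$2 + X$2$2"
proof -
  have ne: "X$1$2 \<noteq> X$2$2"
    using assms(1,3,4) by auto
  have "0 < Y$1$2 \<and> 0 < Y$2$2 \<and> coprime (Y$1$2) (Y$2$2) \<and> Y$1$2 + Y$2$2 < X$1$2 + X$2$2"
  proof (cases "X$2$2 > X$1$2")
    case True
    then show ?thesis
      using sub_div_bounds[OF assms(1) True] assms(1,3,4)
        coprime_sub_mult[of "X$2$2" "X$1$2" "qin_quot X"]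
      by (simp add: Y_def qin_step_def qin_quot_def coprime_commute)
  next
    case False
    with ne have lt: "X$2$2 < X$1$2" by simp
    then show ?thesis
      using sub_div_bounds[OF assms(2) lt] assms(2,3,4)
        coprime_sub_mult[of "X$1$2" "X$2$2" "qin_quot X"]
      by (simp add: Y_def qin_step_def qin_quot_def)
  qed
  then show "0 < Y$1$2" "0 < Y$2$2" "coprime (Y$1$2) (Y$2$2)"
    "Y$1$2 + Y$2$2 < X$1$2 + X$2$2" by auto
qed

lemma qin_step_reaches_1:
  assumes "0 < X$1$2" "0 < X$2$2" "coprime (X$1$2) (X$2$2)"
  shows "\<exists>k. (qin_step ^^ k) X $ 1 $ 2 = 1"
  using assms
proof (induction "nat (X$1$2 + X$2$2)" arbitrary: X rule: less_induct)
  case less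
  show ?case
  proof (cases "X$1$2 = 1")
    case True
    then show ?thesis by (intro exI[of _ 0]) simp
  next
    case False
    note d = qin_step_decreases[OF less.prems False]
    obtain k where "(qin_step ^^ k) (qin_step X) $ 1 $ 2 = 1"
      using less.hyps[OF _ d(1-3)] d(4) less.prems by auto
    then show ?thesis
      by (intro exI[of _ "Suc k"]) (simp add: funpow_swap1)
  qed
qed

lemma qin_terminates:
  assumes "1 < a" "a < m" "gcd a m = 1"
  shows "\<exists>k. qin_state a m k $ 1 $ 2 = 1"
  unfolding qin_state_def
  by (rule qin_step_reaches_1)
    (use assms in \<open>simp_all add: qin_init_def coprime_iff_gcd_eq_1\<close>)

(* Value of a finite continued fraction; as 1 / 0 = 0, the value of a singleton is its entry. *)
fun cfrac_value :: "int list \<Rightarrow> real" where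
  "cfrac_value [] = 0"
| "cfrac_value (x # xs) = of_int x + 1 / cfrac_value xs"

lemma qin_step_ratio:
  assumes "0 < X$1$2" "0 < X$2$2" "coprime (X$1$2) (X$2$2)" "X$1$2 \<noteq> 1"
  defines "Y \<equiv> qin_step X"
  defines "r \<equiv> \<lambda>Z::int^2^2. real_of_int (min (Z$1$2) (Z$2$2)) / real_of_int (max (Z$1$2) (Z$2$2))"
  shows "r X = 1 / (of_int (qin_quot X) + r Y)"
proof -
  have *: "real_of_int v / real_of_int u
      = 1 / (of_int c + real_of_int (min v (u - c * v)) / real_of_int (max v (u - c * v)))"
    if "0 < v" "v < u" and c: "c = (u - 1) div v" for u v c :: int
  proof -
    have "u - 1 < (c + 1) * v"
      using div_mult_mod_eq[of "u - 1" v] pos_mod_bound[OF that(1), of "u - 1"]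
      unfolding c distrib_right by linarith
    then have "u - c * v \<le> v" by (simp add: algebra_simps)
    then show ?thesis
      using that(1,2) by (simp add: min_absorb2 max_absorb1 diff_divide_distrib)
  qed
  have ne: "X$1$2 \<noteq> X$2$2"
    using assms(1,3,4) by auto
  show ?thesis
  proof (cases "X$2$2 > X$1$2")
    case True
    then show ?thesis
      using *[OF assms(1) True refl] assms(4)
      by (simp add: r_def Y_def qin_step_def qin_quot_def)
  next
    case False
    with ne have lt: "X$2$2 < X$1$2" by simp
    then show ?thesis
      using *[OF assms(2) lt refl] assms(4)
      by (simp add: r_def Y_def qin_step_def qin_quot_def min.commute max.commute)
  qed
qed

lemma qin_cfrac_value:
  assumes "1 < a" "a < m" "gcd a m = 1"
  shows "cfrac_value (map (qin_q a m) [0..<qin_N a m + 2]) = of_int a / of_int m"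
proof -
  define N where "N = qin_N a m"
  define X where "X = qin_state a m"
  define r where "r = (\<lambda>Z::int^2^2. real_of_int (min (Z$1$2) (Z$2$2)) / real_of_int (max (Z$1$2) (Z$2$2)))"
  have final: "X N $ 1 $ 2 = 1"
    unfolding X_def N_def qin_N_def by (rule LeastI_ex) (rule qin_terminates[OF assms])
  have not_final: "X k $ 1 $ 2 \<noteq> 1" if "k < N" for k
    using not_less_Least[of k "\<lambda>k. qin_state a m k $ 1 $ 2 = 1"] that
    by (simp add: X_def N_def qin_N_def)
  have Suc: "X (Suc k) = qin_step (X k)" for k
    by (simp add: X_def qin_state_def)
  have inv: "0 < X k $ 1 $ 2 \<and> 0 < X k $ 2 $ 2 \<and> coprime (X k $ 1 $ 2) (X k $ 2 $ 2)"
    if "k \<le> N" for k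
    using that
  proof (induction k)
    case 0
    show ?case
      using assms by (simp add: X_def qin_state_def qin_init_def coprime_iff_gcd_eq_1)
  next
    case (Suc k)
    then show ?case
      using qin_step_decreases(1-3)[of "X k"] not_final[of k] \<open>X (Suc k) = qin_step (X k)\<close>
      by auto
  qed
  have tail: "1 / cfrac_value (map (qin_q a m) [Suc k..<N + 2]) = r (X k)" if "k \<le> N" for k
    using that
  proof (induction k rule: inc_induct)
    case base
    have "0 < X N $ 2 $ 2" using inv[of N] by simp
    then show ?case
      using final by (simp add: r_def qin_q_def N_def X_def)
  next
    case (step k)
    have "r (X k) = 1 / (of_int (qin_quot (X k)) + r (X (Suc k)))"
      using qin_step_ratio[of "X k"] inv[of k] not_final[of k] step.hyps
      by (simp add: r_def Suc)
    moreover have "qin_q a m (Suc k) = qin_quot (X k)"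
      using step.hyps by (simp add: qin_q_def N_def X_def)
    moreover have "[Suc k..<N + 2] = Suc k # [Suc (Suc k)..<N + 2]"
      using step.hyps by (intro upt_conv_Cons) simp
    ultimately show ?case
      using step.IH by simp
  qed
  have "[0..<N + 2] = 0 # [Suc 0..<N + 2]"
    by (intro upt_conv_Cons) simp
  then have "cfrac_value (map (qin_q a m) [0..<N + 2]) = r (X 0)"
    using tail[of 0] by (simp add: qin_q_def)
  also have "\<dots> = of_int a / of_int m"
    using assms by (simp add: r_def X_def qin_state_def qin_init_def)
  finally show ?thesis by (simp add: N_def)
qed

end

theory Submission
  imports Defs
begin

text \<open>
  Written in terms of s-states, both kinds of step of the algorithm are the same row operation:
  the sign put on the upper right entry turns the subtraction in the second column into an addition,
  so a step adds \<open>q\<^sub>k\<close> times one row to the other in both columns at once, and the s-state is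
  multiplied on the left by an elementary matrix (lemma \<open>s_state_Suc\<close>).

  The recurrence of the convergents, \<open>\<beta>\<^sub>k = q\<^sub>k \<beta>\<^sub>k\<^sub>-\<^sub>1 + \<beta>\<^sub>k\<^sub>-\<^sub>2\<close> and likewise for \<open>\<alpha>\<^sub>k\<close>, is the same
  operation on the rows \<open>(\<beta>\<^sub>j, \<alpha>\<^sub>j)\<close>, provided that it always overwrites the older of the two rows.
  Hence the point is that the two kinds of step alternate, the second row being reduced first
  because \<open>a < m\<close>.  This is the effect of the quotient \<open>\<lfloor>(u - 1) / v\<rfloor>\<close>: it leaves a remainder
  in \<open>{1..v}\<close>, and by coprimality the remainder equals \<open>v\<close> only if both are 1, that is, when the
  algorithm has stopped (lemma \<open>qin_state_alternates\<close>).

  The first matrix identity then follows by induction on \<open>k\<close>.  The second one is obtained by carrying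
  out the product with the initial s-state: a row \<open>(\<beta>, \<alpha>)\<close> becomes \<open>(\<beta>, m \<alpha> - a \<beta>)\<close>, and
  \<open>m \<alpha> - a \<beta> = m \<beta> (\<alpha> / \<beta> - a / m)\<close> because \<open>\<beta>\<close> is positive.
\<close>

lemma vec2_eq_iff:
  fixes X Y :: "'a^2^2"
  shows "X = Y \<longleftrightarrow> X$1$1 = Y$1$1 \<and> X$1$2 = Y$1$2 \<and> X$2$1 = Y$2$1 \<and> X$2$2 = Y$2$2"
  by (auto simp: vec_eq_iff forall_2)

lemma mat2_mult:
  fixes X :: "'a::comm_semiring_1^2^2"
  shows "mat2 a b c d ** X =
    mat2 (a * X$1$1 + b * X$2$1) (a * X$1$2 + b * X$2$2)
         (c * X$1$1 + d * X$2$1) (c * X$1$2 + d * X$2$2)"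
  by (simp add: vec2_eq_iff matrix_matrix_mult_def sum_2)

lemma qin_state_Suc: "qin_state a m (Suc k) = qin_step (qin_state a m k)"
  by (simp add: qin_state_def)

lemma qin_state_not_final: "k < qin_N a m \<Longrightarrow> qin_state a m k $ 1 $ 2 \<noteq> 1"
  unfolding qin_N_def by (rule not_less_Least)

lemma qin_state_pos_coprime:
  assumes "1 < a" "a < m" "gcd a m = 1" "k \<le> qin_N a m"
  defines "X \<equiv> qin_state a m k"
  shows "0 < X$1$2" "0 < X$2$2" "coprime (X$1$2) (X$2$2)"
proof -
  have "0 < qin_state a m k $ 1 $ 2 \<and> 0 < qin_state a m k $ 2 $ 2
      \<and> coprime (qin_state a m k $ 1 $ 2) (qin_state a m k $ 2 $ 2)"
    using assms(4)
  proof (induction k)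
    case 0
    then show ?case
      using assms(1-3) by (simp add: qin_state_def qin_init_def coprime_iff_gcd_eq_1)
  next
    case (Suc k)
    then show ?case
      using qin_step_decreases(1-3)[of "qin_state a m k"] qin_state_not_final[of k a m]
      by (auto simp: qin_state_Suc)
  qed
  then show "0 < X$1$2" "0 < X$2$2" "coprime (X$1$2) (X$2$2)"
    by (simp_all add: X_def)
qed

lemma sub_div_le:
  fixes u v :: int
  assumes "0 < v"
  shows "u - (u - 1) div v * v \<le> v"
  using div_mult_mod_eq[of "u - 1" v] pos_mod_bound[OF assms, of "u - 1"] by linarith

text \<open>
  A step brings the reduced entry of the right column down to at most the other one.  Equality
  would make both entries 1 by coprimality, which is excluded before the algorithm stops; so the next
  step has to reduce the other row.
\<close>
lemma qin_state_alternates: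
  assumes "1 < a" "a < m" "gcd a m = 1" "k < qin_N a m"
  defines "X \<equiv> qin_state a m k"
  shows "if even k then X$1$2 < X$2$2 else X$2$2 < X$1$2"
  unfolding X_def using assms(4)
proof (induction k)
  case 0
  then show ?case
    using assms(2) by (simp add: qin_state_def qin_init_def)
next
  case (Suc k)
  let ?X = "qin_state a m k" and ?Y = "qin_state a m (Suc k)"
  have pos: "0 < ?X$1$2" "0 < ?X$2$2"
    using qin_state_pos_coprime[OF assms(1-3), of k] Suc.prems by simp_all
  have nf: "?X$1$2 \<noteq> 1" "?Y$1$2 \<noteq> 1"
    using qin_state_not_final[of _ a m] Suc.prems by auto
  have ne: "?Y$1$2 \<noteq> ?Y$2$2"
    using qin_state_pos_coprime[OF assms(1-3), of "Suc k"] Suc.prems nf(2) by auto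
  have IH: "if even k then ?X$1$2 < ?X$2$2 else ?X$2$2 < ?X$1$2"
    using Suc.IH Suc.prems by simp
  show ?case
  proof (cases "even k")
    case True
    then have "?Y$2$2 \<le> ?Y$1$2"
      using IH nf(1) sub_div_le[OF pos(1), of "?X$2$2"]
      by (simp add: qin_state_Suc qin_step_def qin_quot_def)
    then show ?thesis using True ne by simp
  next
    case False
    then have "?Y$1$2 \<le> ?Y$2$2"
      using IH nf(1) sub_div_le[OF pos(2), of "?X$1$2"]
      by (simp add: qin_state_Suc qin_step_def qin_quot_def)
    then show ?thesis using False ne by simp
  qed
qed

lemma s_state_Suc:
  assumes "1 < a" "a < m" "gcd a m = 1" "k < qin_N a m"
  defines "q \<equiv> qin_q a m (Suc k)"
  shows "s_state a m (Suc k) =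
    (if even k then mat2 1 0 q 1 ** s_state a m k else mat2 1 q 0 1 ** s_state a m k)"
proof -
  have q: "q = qin_quot (qin_state a m k)"
    using assms(4) by (simp add: q_def qin_q_def)
  show ?thesis
    using qin_state_alternates[OF assms(1-4)] qin_state_not_final[OF assms(4)]
    by (auto simp: s_state_def Let_def mat2_mult qin_state_Suc qin_step_def q algebra_simps)
qed

text \<open>
  At \<open>k = 1\<close> the convergent matrix is the elementary matrix of the first step itself, because
  \<open>(\<beta>\<^sub>0, \<alpha>\<^sub>0) = (1, 0)\<close> and \<open>(\<beta>\<^sub>1, \<alpha>\<^sub>1) = (q\<^sub>1, 1)\<close>.
\<close>
lemma s_state_eq_convergents_mult:
  assumes "1 < a" "a < m" "gcd a m = 1" "1 \<le> k" "k \<le> qin_N a m"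
  defines "\<alpha> \<equiv> conv_num (qin_q a m)" and "\<beta> \<equiv> conv_den (qin_q a m)"
  shows "s_state a m k =
    (if odd k then mat2 (\<beta> (k-1)) (\<alpha> (k-1)) (\<beta> k) (\<alpha> k)
     else mat2 (\<beta> k) (\<alpha> k) (\<beta> (k-1)) (\<alpha> (k-1))) ** s_state a m 0"
  using assms(4,5)
proof (induction k rule: nat_induct_at_least)
  case base
  then show ?case
    using s_state_Suc[OF assms(1-3), of 0] by (simp add: \<alpha>_def \<beta>_def)
next
  case (Suc k)
  then obtain j where k: "k = Suc j" by (cases k) auto
  show ?case
    using Suc s_state_Suc[OF assms(1-3), of k]
    by (auto simp: matrix_mul_assoc mat2_mult \<alpha>_def \<beta>_def k algebra_simps)
qed

lemma qin_q_pos: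
  assumes "1 < a" "a < m" "gcd a m = 1" "1 \<le> k" "k \<le> qin_N a m"
  shows "0 < qin_q a m k"
proof -
  obtain j where k: "k = Suc j" using assms(4) by (cases k) auto
  have j: "j < qin_N a m" using assms(5) k by simp
  show ?thesis
    using qin_state_alternates[OF assms(1-3) j] qin_state_pos_coprime[OF assms(1-3), of j] j
    by (auto simp: k qin_q_def qin_quot_def pos_imp_zdiv_pos_iff split: if_splits)
qed

lemma conv_den_pos:
  assumes "\<And>j. 1 \<le> j \<Longrightarrow> j \<le> k \<Longrightarrow> 0 < q j"
  shows "0 < conv_den q k"
  using assms by (induction q k rule: conv_den.induct) (auto intro!: add_pos_pos mult_pos_pos)

lemma scaled_convergent_error:
  fixes a b m n :: real
  assumes "m \<noteq> 0" "b \<noteq> 0"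
  shows "m * b * (n / b - a / m) = m * n - a * b"
  using assms by (simp add: field_simps)

theorem theorem3p1:
  fixes a m :: int and lam :: real and \<alpha> \<beta> :: "nat \<Rightarrow> int" and k :: nat
  assumes "1 < a" and "a < m" and "gcd a m = 1"
    and "lam = real_of_int a / real_of_int m"
    and "\<alpha> = conv_num (qin_q a m)"
    and "\<beta> = conv_den (qin_q a m)"
    and "1 \<le> k" and "k \<le> qin_N a m"
  shows "s_state a m k =
      (if odd k then mat2 (\<beta> (k-1)) (\<alpha> (k-1)) (\<beta> k) (\<alpha> k) ** s_state a m 0
       else mat2 (\<beta> k) (\<alpha> k) (\<beta> (k-1)) (\<alpha> (k-1)) ** s_state a m 0)
    \<and> map_matrix real_of_int (s_state a m k) =
      (if odd k then
         mat2 (real_of_int (\<beta> (k-1)))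
              (real_of_int m * real_of_int (\<beta> (k-1)) *
                (real_of_int (\<alpha> (k-1)) / real_of_int (\<beta> (k-1)) - lam))
              (real_of_int (\<beta> k))
              (real_of_int m * real_of_int (\<beta> k) *
                (real_of_int (\<alpha> k) / real_of_int (\<beta> k) - lam))
       else
         mat2 (real_of_int (\<beta> k))
              (real_of_int m * real_of_int (\<beta> k) *
                (real_of_int (\<alpha> k) / real_of_int (\<beta> k) - lam))
              (real_of_int (\<beta> (k-1)))
              (real_of_int m * real_of_int (\<beta> (k-1)) *
                (real_of_int (\<alpha> (k-1)) / real_of_int (\<beta> (k-1)) - lam)))"
proof -
  have product: "s_state a m k =
      (if odd k then mat2 (\<beta> (k-1)) (\<alpha> (k-1)) (\<beta> k) (\<alpha> k)
       else mat2 (\<beta> k) (\<alpha> k) (\<beta> (k-1)) (\<alpha> (k-1))) ** s_state a m 0"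
    using s_state_eq_convergents_mult assms by simp
  have \<beta>_pos: "0 < \<beta> j" if "j \<le> k" for j
    unfolding assms(6) using that assms(8)
    by (intro conv_den_pos qin_q_pos[OF assms(1-3)]) auto
  have error: "real_of_int m * real_of_int (\<beta> j) * (real_of_int (\<alpha> j) / real_of_int (\<beta> j) - lam)
      = real_of_int (m * \<alpha> j - a * \<beta> j)" if "j \<le> k" for j
    using scaled_convergent_error[of "real_of_int m" "real_of_int (\<beta> j)"] \<beta>_pos[OF that] assms(1,2,4)
    by simp
  have init: "s_state a m 0 = mat2 1 (- a) 0 m"
    by (simp add: s_state_def qin_state_def qin_init_def)
  have "map_matrix real_of_int (s_state a m k) =
      (if odd k then
         mat2 (real_of_int (\<beta> (k-1))) (real_of_int (m * \<alpha> (k-1) - a * \<beta> (k-1)))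
              (real_of_int (\<beta> k)) (real_of_int (m * \<alpha> k - a * \<beta> k))
       else
         mat2 (real_of_int (\<beta> k)) (real_of_int (m * \<alpha> k - a * \<beta> k))
              (real_of_int (\<beta> (k-1))) (real_of_int (m * \<alpha> (k-1) - a * \<beta> (k-1))))"
    unfolding product init mat2_mult
    by (simp add: vec2_eq_iff map_matrix_def mat2_mult algebra_simps)
  then show ?thesis
    using product by (simp add: error)
qed

end
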